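(* Let $n\geq 2$ and $d=2n$, and let Alice and Bob hold systems $A$ and $B$, each with Hilbert space $\mathbb{C}^d$ and standard orthonormal basis $|0\rangle,\dots,|d-1\rangle$. Let $\omega=e^{2\pi i/n}$. Consider the following set of mutually orthogonal (unnormalized) product states in $\mathbb{C}^d\otimes\mathbb{C}^d$: for $m=1,\dots,n-1$ and $k=0,\dots,d-1$, $$|V_{mk}\rangle=|k\rangle\otimes\sum_{j=0}^{n-1}\omega^{jm}\,|j+k+1 \bmod d\rangle,\qquad |H_{mk}\rangle=\Big(\sum_{j=0}^{n-1}\omega^{jm}\,|j+k \bmod d\rangle\Big)\otimes|k\rangle,$$ together with the stopper state $$|F\rangle=\sum_{i=0}^{d-1}\sum_{j=0}^{d-1}|i\rangle\otimes|j\rangle .$$ Then the states $|V_{mk}\rangle,|H_{mk}\rangle$ ($1\le m\le n-1$, $0\le k\le d-1$) and $|F\rangle$ can be perfectly distinguished by LOCC with the assistance of $n-1$ copies of a $2\otimes 2$ maximally entangled state shared between Alice and Bob.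
   Context: The first tensor factor belongs to Alice, the second to Bob; $i=\sqrt{-1}$ in the definition of $\omega$; in the kets $|j+k+1 \bmod d\rangle$ and $|j+k\bmod d\rangle$ the label is the integer in $\{0,\dots,d-1\}$ obtained by reduction modulo $d$. Normalization constants are ignored. A $2\otimes 2$ maximally entangled state is the state (proportional to) $|00\rangle+|11\rangle\in\mathbb{C}^2\otimes\mathbb{C}^2$. By $r$ copies is meant the shared state $|\Psi\rangle=\bigotimes_{l=1}^{r}|\Psi\rangle_{a_lb_l}$ with each factor $|00\rangle+|11\rangle$, where Alice holds $a=a_1\cdots a_r$ and Bob holds $b=b_1\cdots b_r$. LOCC (local operations and classical communication): a protocol consists of finitely many rounds; in each round one of the parties performs a quantum measurement (Kraus operators $\{M_x\}$ with $\sum_x M_x^\dagger M_x=I$) acting only on that party's own systems, the choice of the measurement being allowed to depend on all previous outcomes, and the outcome is communicated to the other party. A finite set $S$ of pairwise orthogonal states of $AB$ is perfectly distinguished by LOCC with the assistance of a shared entangled state $|\Psi\rangle_{ab}$ if there is an LOCC protocol, in which Alice acts on $aA$ and Bob acts on $bB$, such that when it is applied to $|\phi\rangle_{AB}\otimes|\Psi\rangle_{ab}$ with $|\phi\rangle\in S$ unknown, the sequence of measurement outcomes determines $|\phi\rangle$ with certainty; i.e. for every complete sequence of outcomes, at most one $|\phi\rangle\in S$ gives it nonzero probability. *)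

theory Defs
  imports Complex_Main
begin

text \<open>
  A vector of the Hilbert space with orthonormal basis indexed by a finite set \<open>X\<close> is given by
  its amplitudes, an operator on this space by its matrix entries. The index set is passed
  explicitly wherever it is summed over; values outside it are irrelevant.
\<close>

type_synonym 'i vect = "'i \<Rightarrow> complex"
type_synonym 'i oper = "'i \<Rightarrow> 'i \<Rightarrow> complex"

definition ket :: "'i \<Rightarrow> 'i vect" where
  "ket i = (\<lambda>x. of_bool (x = i))"

definition tensor :: "'i vect \<Rightarrow> 'j vect \<Rightarrow> ('i \<times> 'j) vect" where
  "tensor u v = (\<lambda>(x, y). u x * v y)"

definition inner_on :: "'i set \<Rightarrow> 'i vect \<Rightarrow> 'i vect \<Rightarrow> complex" where
  "inner_on X u v = (\<Sum>x\<in>X. cnj (u x) * v x)"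

definition norm_sq_on :: "'i set \<Rightarrow> 'i vect \<Rightarrow> real" where
  "norm_sq_on X u = (\<Sum>x\<in>X. (cmod (u x))\<^sup>2)"

definition id_op :: "'i oper" where
  "id_op = (\<lambda>x y. of_bool (x = y))"

definition adj_op :: "'i oper \<Rightarrow> 'i oper" where
  "adj_op M = (\<lambda>x y. cnj (M y x))"

definition mult_op :: "'i set \<Rightarrow> 'i oper \<Rightarrow> 'i oper \<Rightarrow> 'i oper" where
  "mult_op X M N = (\<lambda>x y. \<Sum>z\<in>X. M x z * N z y)"

definition apply_op :: "'i set \<Rightarrow> 'i oper \<Rightarrow> 'i vect \<Rightarrow> 'i vect" where
  "apply_op X M u = (\<lambda>x. \<Sum>y\<in>X. M x y * u y)"

definition tensor_op :: "'i oper \<Rightarrow> 'j oper \<Rightarrow> ('i \<times> 'j) oper" where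
  "tensor_op M N = (\<lambda>(x, y) (x', y'). M x x' * N y y')"

definition is_measurement :: "'i set \<Rightarrow> 'i oper list \<Rightarrow> bool" where
  "is_measurement X Ms \<longleftrightarrow>
     (\<forall>x\<in>X. \<forall>y\<in>X. (\<Sum>M\<leftarrow>Ms. mult_op X (adj_op M) M x y) = id_op x y)"

text \<open>
  A protocol is a finite tree: a node names the acting party and lists its Kraus operators, each
  together with the protocol followed after that outcome is obtained and announced. Thus the
  measurement at a node may depend on all previous outcomes.
\<close>

datatype ('a, 'b) locc =
    Stop
  | Alice "(('a oper) \<times> ('a, 'b) locc) list"
  | Bob "(('b oper) \<times> ('a, 'b) locc) list"

inductive is_locc :: "'a set \<Rightarrow> 'b set \<Rightarrow> ('a, 'b) locc \<Rightarrow> bool"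
  for X :: "'a set" and Y :: "'b set" where
  Stop: "is_locc X Y Stop"
| Alice: "is_measurement X (map fst bs) \<Longrightarrow> (\<And>M P. (M, P) \<in> set bs \<Longrightarrow> is_locc X Y P)
    \<Longrightarrow> is_locc X Y (Alice bs)"
| Bob: "is_measurement Y (map fst bs) \<Longrightarrow> (\<And>M P. (M, P) \<in> set bs \<Longrightarrow> is_locc X Y P)
    \<Longrightarrow> is_locc X Y (Bob bs)"

text \<open>Outcomes of a measurement are numbered by their position in the list of Kraus operators.\<close>

fun complete_outcomes :: "('a, 'b) locc \<Rightarrow> nat list \<Rightarrow> bool" where
  "complete_outcomes Stop [] \<longleftrightarrow> True"
| "complete_outcomes (Alice bs) (x # xs) \<longleftrightarrow> x < length bs \<and> complete_outcomes (snd (bs ! x)) xs"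
| "complete_outcomes (Bob bs) (x # xs) \<longleftrightarrow> x < length bs \<and> complete_outcomes (snd (bs ! x)) xs"
| "complete_outcomes _ _ \<longleftrightarrow> False"

text \<open>The unnormalized state after a sequence of outcomes; only meant for complete sequences.\<close>

fun post_state ::
  "'a set \<Rightarrow> 'b set \<Rightarrow> ('a, 'b) locc \<Rightarrow> nat list \<Rightarrow> ('a \<times> 'b) vect \<Rightarrow> ('a \<times> 'b) vect" where
  "post_state X Y (Alice bs) (x # xs) \<psi> =
     post_state X Y (snd (bs ! x)) xs (apply_op (X \<times> Y) (tensor_op (fst (bs ! x)) id_op) \<psi>)"
| "post_state X Y (Bob bs) (x # xs) \<psi> =
     post_state X Y (snd (bs ! x)) xs (apply_op (X \<times> Y) (tensor_op id_op (fst (bs ! x))) \<psi>)"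
| "post_state X Y _ _ \<psi> = \<psi>"

text \<open>Born rule, with the initial state \<open>\<psi>\<close> normalized.\<close>

definition outcome_prob ::
  "'a set \<Rightarrow> 'b set \<Rightarrow> ('a, 'b) locc \<Rightarrow> nat list \<Rightarrow> ('a \<times> 'b) vect \<Rightarrow> real" where
  "outcome_prob X Y P xs \<psi> =
     norm_sq_on (X \<times> Y) (post_state X Y P xs \<psi>) / norm_sq_on (X \<times> Y) \<psi>"

text \<open>
  The tensor product of a state \<open>\<phi>\<close> of \<open>AB\<close> and a state \<open>\<Psi>\<close> of \<open>ab\<close>, with its factors regrouped as
  \<open>(aA)(bB)\<close>.
\<close>

definition with_resource ::
  "('p \<times> 'q) vect \<Rightarrow> ('i \<times> 'j) vect \<Rightarrow> (('p \<times> 'i) \<times> ('q \<times> 'j)) vect" where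
  "with_resource \<Psi> \<phi> = (\<lambda>((a, x), (b, y)). tensor \<phi> \<Psi> ((x, y), (a, b)))"

text \<open>
  \<open>A\<close>, \<open>B\<close> are the basis index sets of the systems carrying the unknown state from \<open>S\<close>, and \<open>a\<close>, \<open>b\<close>
  those of the systems carrying the shared resource \<open>\<Psi>\<close>.
\<close>

definition locc_distinguishable_with ::
  "'p set \<Rightarrow> 'q set \<Rightarrow> ('p \<times> 'q) vect \<Rightarrow> 'i set \<Rightarrow> 'j set \<Rightarrow> ('i \<times> 'j) vect set \<Rightarrow> bool" where
  "locc_distinguishable_with a b \<Psi> A B S \<longleftrightarrow>
     (\<exists>P. is_locc (a \<times> A) (b \<times> B) P \<and>
       (\<forall>xs. complete_outcomes P xs \<longrightarrow>
         (\<exists>\<^sub>\<le>\<^sub>1\<phi>. \<phi> \<in> S \<and>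
            outcome_prob (a \<times> A) (b \<times> B) P xs (with_resource \<Psi> \<phi>) \<noteq> 0)))"

definition bell :: "(nat \<times> nat) vect" where
  "bell = (\<lambda>z. tensor (ket 0) (ket 0) z + tensor (ket 1) (ket 1) z)"

definition qubit_strings :: "nat \<Rightarrow> nat list set" where
  "qubit_strings r = {s. length s = r \<and> set s \<subseteq> {0, 1}}"

text \<open>The \<open>r\<close>-fold tensor power of \<open>bell\<close>, with the factors regrouped as \<open>(a\<^sub>1 \<dots> a\<^sub>r)(b\<^sub>1 \<dots> b\<^sub>r)\<close>.\<close>

definition bell_copies :: "nat \<Rightarrow> (nat list \<times> nat list) vect" where
  "bell_copies r = (\<lambda>(s, t). \<Prod>l<r. bell (s ! l, t ! l))"

definition root_of_unity :: "nat \<Rightarrow> complex" where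
  "root_of_unity n = exp (2 * of_real pi * \<i> / of_nat n)"

definition V_state :: "nat \<Rightarrow> nat \<Rightarrow> nat \<Rightarrow> nat \<Rightarrow> (nat \<times> nat) vect" where
  "V_state n d m k =
     tensor (ket k) (\<lambda>y. \<Sum>j<n. root_of_unity n ^ (j * m) * ket ((j + k + 1) mod d) y)"

definition H_state :: "nat \<Rightarrow> nat \<Rightarrow> nat \<Rightarrow> nat \<Rightarrow> (nat \<times> nat) vect" where
  "H_state n d m k =
     tensor (\<lambda>x. \<Sum>j<n. root_of_unity n ^ (j * m) * ket ((j + k) mod d) x) (ket k)"

definition stopper :: "nat \<Rightarrow> (nat \<times> nat) vect" where
  "stopper d = (\<lambda>z. \<Sum>i<d. \<Sum>j<d. tensor (ket i) (ket j) z)"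

definition state_set :: "nat \<Rightarrow> nat \<Rightarrow> (nat \<times> nat) vect set" where
  "state_set n d =
     {V_state n d m k | m k. m \<in> {1..n-1} \<and> k < d} \<union>
     {H_state n d m k | m k. m \<in> {1..n-1} \<and> k < d} \<union> {stopper d}"

end

theory Submission
  imports Defs
begin

text \<open>
  The supports of the states \<open>V\<^sub>m\<^sub>k\<close> with \<open>k\<close> fixed, and likewise of the \<open>H\<^sub>m\<^sub>k\<close>, form \<open>2d\<close> tiles which partition
  the \<open>d \<times> d\<close> square of basis states. On its tile each such state is a nontrivial Fourier vector, and the stopper
  is constant on every tile, so it suffices to project onto the tiles by LOCC and then to
  distinguish the Fourier vectors of one tile.

  Rows \<open>0, 1\<close> are put into one class, so are rows \<open>n, n + 1\<close>, and every other row is a class of its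
  own. These are \<open>2n - 2 \<le> 2 ^ (n - 1)\<close> classes, so the resource suffices to share the class of
  Alice's row coherently with Bob. Bob then sees the column and the row class, which determine the
  tile unless it is one of \<open>V\<^sub>0, V\<^sub>1, V\<^sub>n, V\<^sub>n\<^sub>+\<^sub>1, H\<^sub>1, H\<^sub>n\<^sub>+\<^sub>1\<close>. In that case Alice can separate the
  rows \<open>1, \<dots>, n\<close> from the others without cutting one of these six tiles, after which the class
  determines the row, and Bob can complete the projection.
\<close>

section \<open>Orthogonality of Fourier vectors\<close>

lemma root_of_unity_power: "root_of_unity n ^ j = cis (2 * pi * real j / real n)"
  unfolding root_of_unity_def cis_conv_exp exp_of_nat_mult[symmetric]
  by (simp add: algebra_simps)

lemma root_of_unity_power_inject:
  assumes "i < n" "j < n" "root_of_unity n ^ i = root_of_unity n ^ j"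
  shows "i = j"
proof -
  have "inj_on (\<lambda>k. cis (2 * pi * real k / real n)) {..<n}"
    using bij_betw_roots_unity[of n] assms(1) by (auto simp: bij_betw_def)
  then show ?thesis
    using assms by (auto simp: root_of_unity_power dest: inj_onD)
qed

text \<open>For \<open>i\<close> different from \<open>j\<close> this is a geometric sum whose ratio
  is an \<open>n\<close>-th root of unity other than 1; the ratio avoids 1 because the powers below
  \<open>n\<close> are distinct.\<close>

lemma fourier_orthogonal:
  assumes "i < n" "j < n"
  shows "(\<Sum>l<n. cnj (root_of_unity n ^ (l * i)) * root_of_unity n ^ (l * j)) = of_nat n * of_bool (i = j)"
proof -
  define z where "z = cnj (root_of_unity n ^ i) * root_of_unity n ^ j"
  have one: "cnj (root_of_unity n ^ i) * root_of_unity n ^ i = 1" for i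
    unfolding root_of_unity_power cis_cnj by (simp add: cis_mult)
  have sum: "(\<Sum>l<n. cnj (root_of_unity n ^ (l * i)) * root_of_unity n ^ (l * j)) = (\<Sum>l<n. z ^ l)"
    unfolding z_def by (simp add: power_mult_distrib power_mult mult.commute[of _ i] mult.commute[of _ j])
  show ?thesis
  proof (cases "i = j")
    case True
    then show ?thesis unfolding sum using one by (simp add: z_def)
  next
    case False
    have "z \<noteq> 1"
    proof
      assume "z = 1"
      then have "root_of_unity n ^ i * z = root_of_unity n ^ i" by simp
      then have "root_of_unity n ^ j = root_of_unity n ^ i"
        using one[of i] unfolding z_def by (metis mult.assoc mult.commute mult_1)
      then show False using root_of_unity_power_inject assms False by blast
    qed
    moreover have "root_of_unity n ^ n = 1"
      using assms by (simp add: root_of_unity_power)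
    then have "z ^ n = 1"
      unfolding z_def by (metis complex_cnj_one complex_cnj_power mult_1 power_mult_distrib power_mult mult.commute power_one)
    ultimately show ?thesis
      unfolding sum using False by (simp add: geometric_sum)
  qed
qed

section \<open>Discrimination of indexed families of states\<close>

text \<open>Indexing by \<open>K\<close> keeps the identity of states that a measurement has mapped
  to zero or to the same vector, so the predicate can be propagated through the protocol
  tree.\<close>

definition discriminable :: "'a set \<Rightarrow> 'b set \<Rightarrow> 'k set \<Rightarrow> ('k \<Rightarrow> ('a \<times> 'b) vect) \<Rightarrow> bool" where
  "discriminable X Y K \<psi> \<longleftrightarrow>
     (\<exists>P. is_locc X Y P \<and>
       (\<forall>xs. complete_outcomes P xs \<longrightarrow>
         (\<exists>\<^sub>\<le>\<^sub>1k. k \<in> K \<and> (\<exists>z\<in>X \<times> Y. post_state X Y P xs (\<psi> k) z \<noteq> 0))))"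

lemma apply_op_cong:
  assumes "\<And>z. z \<in> X \<Longrightarrow> u z = v z"
  shows "apply_op X M u = apply_op X M v"
  using assms by (auto simp: apply_op_def intro!: sum.cong)

lemma post_state_cong:
  assumes "\<And>z. z \<in> X \<times> Y \<Longrightarrow> u z = v z" "z \<in> X \<times> Y"
  shows "post_state X Y P xs u z = post_state X Y P xs v z"
  using assms apply_op_cong[of "X \<times> Y" u v]
  by (cases P; cases xs) auto

lemma discriminable_cong:
  assumes "\<And>k z. k \<in> K \<Longrightarrow> z \<in> X \<times> Y \<Longrightarrow> \<psi> k z = \<psi>' k z" "discriminable X Y K \<psi>"
  shows "discriminable X Y K \<psi>'"
proof -
  obtain P where P: "is_locc X Y P" "\<And>xs. complete_outcomes P xs \<Longrightarrow>
         (\<exists>\<^sub>\<le>\<^sub>1k. k \<in> K \<and> (\<exists>z\<in>X \<times> Y. post_state X Y P xs (\<psi> k) z \<noteq> 0))"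
    using assms(2) unfolding discriminable_def by blast
  have eq: "post_state X Y P xs (\<psi> k) z = post_state X Y P xs (\<psi>' k) z" if "k \<in> K" "z \<in> X \<times> Y" for xs k z
    by (rule post_state_cong[OF assms(1)]) (use that in auto)
  have "(k \<in> K \<and> (\<exists>z\<in>X \<times> Y. post_state X Y P xs (\<psi> k) z \<noteq> 0)) =
    (k \<in> K \<and> (\<exists>z\<in>X \<times> Y. post_state X Y P xs (\<psi>' k) z \<noteq> 0))" for k xs
    by (simp add: eq cong: conj_cong bex_cong del: mem_Sigma_iff split_paired_Bex_Sigma)
  with P show ?thesis unfolding discriminable_def by (intro exI[of _ P]) simp
qed

lemma discriminable_stop:
  assumes "\<And>k l z w. k \<in> K \<Longrightarrow> l \<in> K \<Longrightarrow> z \<in> X \<times> Y \<Longrightarrow> w \<in> X \<times> Y \<Longrightarrow> \<psi> k z \<noteq> 0 \<Longrightarrow> \<psi> l w \<noteq> 0 \<Longrightarrow> k = l"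
  shows "discriminable X Y K \<psi>"
  unfolding discriminable_def
proof (intro exI[of _ Stop] conjI allI impI)
  fix xs :: "nat list"
  show "\<exists>\<^sub>\<le>\<^sub>1k. k \<in> K \<and> (\<exists>z\<in>X \<times> Y. post_state X Y Stop xs (\<psi> k) z \<noteq> 0)"
    unfolding Uniq_def post_state.simps using assms by blast
qed (rule is_locc.Stop)

text \<open>The continuation is chosen per operator rather than per position, so equal operators in
  \<open>Ms\<close> share it.\<close>

lemma discriminable_alice:
  assumes "is_measurement X Ms"
    and "\<And>M. M \<in> set Ms \<Longrightarrow> discriminable X Y K (\<lambda>k. apply_op (X \<times> Y) (tensor_op M id_op) (\<psi> k))"
  shows "discriminable X Y K \<psi>"
proof -
  obtain P where P: "\<And>M. M \<in> set Ms \<Longrightarrow> is_locc X Y (P M)"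
    "\<And>M xs. M \<in> set Ms \<Longrightarrow> complete_outcomes (P M) xs \<Longrightarrow>
      \<exists>\<^sub>\<le>\<^sub>1k. k \<in> K \<and> (\<exists>z\<in>X \<times> Y. post_state X Y (P M) xs (apply_op (X \<times> Y) (tensor_op M id_op) (\<psi> k)) z \<noteq> 0)"
  proof -
    have "\<forall>M\<in>set Ms. \<exists>P. is_locc X Y P \<and> (\<forall>xs. complete_outcomes P xs \<longrightarrow>
      (\<exists>\<^sub>\<le>\<^sub>1k. k \<in> K \<and> (\<exists>z\<in>X \<times> Y. post_state X Y P xs (apply_op (X \<times> Y) (tensor_op M id_op) (\<psi> k)) z \<noteq> 0)))"
      using assms(2) unfolding discriminable_def by blast
    from bchoice[OF this] show thesis using that by blast
  qed
  show ?thesis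
    unfolding discriminable_def
  proof (intro exI[of _ "Alice (map (\<lambda>M. (M, P M)) Ms)"] conjI allI impI)
    show "is_locc X Y (Alice (map (\<lambda>M. (M, P M)) Ms))"
    proof (rule is_locc.Alice)
      show "is_measurement X (map fst (map (\<lambda>M. (M, P M)) Ms))"
        using assms(1) by (simp add: comp_def)
    qed (use P(1) in auto)
  next
    fix xs
    assume xs: "complete_outcomes (Alice (map (\<lambda>M. (M, P M)) Ms)) xs"
    then obtain y ys where "xs = y # ys" "y < length Ms" "complete_outcomes (P (Ms ! y)) ys"
      by (cases xs) auto
    then show "\<exists>\<^sub>\<le>\<^sub>1k. k \<in> K \<and> (\<exists>z\<in>X \<times> Y. post_state X Y (Alice (map (\<lambda>M. (M, P M)) Ms)) xs (\<psi> k) z \<noteq> 0)"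
      using P(2)[of "Ms ! y" ys] by simp
  qed
qed

section \<open>Exchange of the two parties\<close>

primrec flip :: "('a, 'b) locc \<Rightarrow> ('b, 'a) locc" where
  "flip Stop = Stop"
| "flip (Alice bs) = Bob (map (map_prod id flip) bs)"
| "flip (Bob bs) = Alice (map (map_prod id flip) bs)"

lemma is_locc_flip: "is_locc X Y P \<Longrightarrow> is_locc Y X (flip P)"
proof (induction rule: is_locc.induct)
  case Stop
  show ?case by (simp add: is_locc.Stop)
next
  case (Alice bs)
  have "map fst (map (map_prod id flip) bs) = map fst bs" by simp
  then show ?case
    using Alice by (auto simp del: map_map intro!: is_locc.Bob)
next
  case (Bob bs)
  have "map fst (map (map_prod id flip) bs) = map fst bs" by simp
  then show ?case
    using Bob by (auto simp del: map_map intro!: is_locc.Alice)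
qed

lemma complete_outcomes_flip: "complete_outcomes (flip P) xs \<longleftrightarrow> complete_outcomes P xs"
proof (induction xs arbitrary: P)
  case Nil
  then show ?case by (cases P) simp_all
next
  case (Cons x xs)
  then show ?case by (cases P) (simp_all cong: conj_cong)
qed

definition swap_vect :: "('a \<times> 'b) vect \<Rightarrow> ('b \<times> 'a) vect" where
  "swap_vect u = (\<lambda>z. u (prod.swap z))"

lemma swap_vect_apply [simp]: "swap_vect u (q, p) = u (p, q)"
  by (simp add: swap_vect_def)

lemma swap_vect_swap_vect [simp]: "swap_vect (swap_vect u) = u"
  by (simp add: swap_vect_def)

lemma apply_op_swap:
  "apply_op (Y \<times> X) (tensor_op N M) (swap_vect \<psi>) = swap_vect (apply_op (X \<times> Y) (tensor_op M N) \<psi>)"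
proof
  fix z
  have "(\<Sum>w\<in>Y \<times> X. tensor_op N M z w * \<psi> (prod.swap w)) =
    (\<Sum>w\<in>X \<times> Y. tensor_op M N (prod.swap z) w * \<psi> w)"
    by (rule sum.reindex_bij_witness[of _ prod.swap prod.swap])
      (auto simp: tensor_op_def split: prod.splits)
  then show "apply_op (Y \<times> X) (tensor_op N M) (swap_vect \<psi>) z = swap_vect (apply_op (X \<times> Y) (tensor_op M N) \<psi>) z"
    by (simp add: apply_op_def swap_vect_def)
qed

text \<open>Completeness makes every outcome a valid position in its list, and only there is
  \<open>!\<close> known to commute with \<open>map\<close>.\<close>

lemma post_state_flip:
  "complete_outcomes P xs \<Longrightarrow>
    post_state Y X (flip P) xs (swap_vect \<psi>) = swap_vect (post_state X Y P xs \<psi>)"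
proof (induction xs arbitrary: P \<psi>)
  case Nil
  then show ?case by (cases P) simp_all
next
  case (Cons x xs)
  then show ?case by (cases P) (simp_all add: apply_op_swap)
qed

text \<open>By this symmetry only measurements of Alice need a direct analysis; those of Bob are
  reduced to them.\<close>

lemma discriminable_flip:
  assumes "discriminable Y X K (\<lambda>k. swap_vect (\<psi> k))"
  shows "discriminable X Y K \<psi>"
proof -
  obtain P where P: "is_locc Y X P" "\<And>xs. complete_outcomes P xs \<Longrightarrow>
         (\<exists>\<^sub>\<le>\<^sub>1k. k \<in> K \<and> (\<exists>z\<in>Y \<times> X. post_state Y X P xs (swap_vect (\<psi> k)) z \<noteq> 0))"
    using assms unfolding discriminable_def by blast
  have "post_state X Y (flip P) xs (\<psi> k) = swap_vect (post_state Y X P xs (swap_vect (\<psi> k)))"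
    if "complete_outcomes P xs" for xs k
    using post_state_flip[OF that, of X Y "swap_vect (\<psi> k)"] by simp
  then have "(\<exists>z\<in>X \<times> Y. post_state X Y (flip P) xs (\<psi> k) z \<noteq> 0) \<longleftrightarrow>
      (\<exists>z\<in>Y \<times> X. post_state Y X P xs (swap_vect (\<psi> k)) z \<noteq> 0)"
    if "complete_outcomes P xs" for xs k
    using that by auto
  with P(2) is_locc_flip[OF P(1)] show ?thesis
    unfolding discriminable_def
    by (intro exI[of _ "flip P"] conjI allI impI) (simp_all only: complete_outcomes_flip)
qed

section \<open>Local measurements\<close>

lemma apply_op_alice:
  assumes "finite X" "finite Y" "q \<in> Y"
  shows "apply_op (X \<times> Y) (tensor_op M id_op) \<psi> (p, q) = (\<Sum>p'\<in>X. M p p' * \<psi> (p', q))"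
proof -
  have "apply_op (X \<times> Y) (tensor_op M id_op) \<psi> (p, q) =
    (\<Sum>p'\<in>X. \<Sum>q'\<in>Y. M p p' * of_bool (q = q') * \<psi> (p', q'))"
    unfolding apply_op_def tensor_op_def id_op_def sum.cartesian_product
    by (rule sum.cong) auto
  also have "\<dots> = (\<Sum>p'\<in>X. M p p' * \<psi> (p', q))"
  proof (rule sum.cong)
    fix p'
    have "(\<Sum>q'\<in>Y. M p p' * of_bool (q = q') * \<psi> (p', q')) =
      (\<Sum>q'\<in>Y. if q = q' then M p p' * \<psi> (p', q') else 0)"
      by (rule sum.cong) auto
    then show "(\<Sum>q'\<in>Y. M p p' * of_bool (q = q') * \<psi> (p', q')) = M p p' * \<psi> (p', q)"
      using assms by simp
  qed simp
  finally show ?thesis .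
qed

text \<open>A projection without renormalization, onto any set of joint labels. Until a single tile
  is left, the protocol only applies such cuts to the initial states, so its analysis is a matter of
  sets.\<close>

definition cut :: "'i set \<Rightarrow> 'i vect \<Rightarrow> 'i vect" where
  "cut R u = (\<lambda>z. of_bool (z \<in> R) * u z)"

lemma cut_cut: "cut R (cut S u) = cut (R \<inter> S) u"
  by (auto simp: cut_def)

lemma discriminable_alice_project:
  assumes fin: "finite X" "finite Y"
    and D: "\<And>v. discriminable X Y K (\<lambda>k. cut {z. f (fst z) = v} (\<psi> k))"
  shows "discriminable X Y K \<psi>"
proof -
  define Pr where "Pr v = (\<lambda>p p'. of_bool (p = p' \<and> f p = v) :: complex)" for v
  obtain vs where vs: "set vs = f ` X" "distinct vs"
    using finite_distinct_list[of "f ` X"] fin by auto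
  have "mult_op X (adj_op (Pr v)) (Pr v) x y = of_bool (x = y \<and> f x = v)" if "x \<in> X" for v x y
  proof -
    have "mult_op X (adj_op (Pr v)) (Pr v) x y = (\<Sum>z\<in>X. if z = x then of_bool (x = y \<and> f x = v) else 0)"
      unfolding mult_op_def adj_op_def Pr_def by (rule sum.cong) auto
    then show ?thesis using that fin by simp
  qed
  then have "(\<Sum>v\<leftarrow>vs. mult_op X (adj_op (Pr v)) (Pr v) x y) = id_op x y" if "x \<in> X" "y \<in> X" for x y
    using that vs fin by (simp add: sum_list_distinct_conv_sum_set id_op_def of_bool_conj)
  then have meas: "is_measurement X (map Pr vs)"
    unfolding is_measurement_def by (simp add: comp_def)
  show ?thesis
  proof (rule discriminable_alice[OF meas])
    fix M
    assume "M \<in> set (map Pr vs)"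
    then obtain v where v: "M = Pr v" by auto
    have "cut {z. f (fst z) = v} (\<psi> k) z = apply_op (X \<times> Y) (tensor_op M id_op) (\<psi> k) z" if z: "z \<in> X \<times> Y" for k z
    proof -
      obtain p q where pq: "z = (p, q)" "p \<in> X" "q \<in> Y" using z by auto
      have "(\<Sum>p'\<in>X. Pr v p p' * \<psi> k (p', q)) = (\<Sum>p'\<in>X. if p' = p then of_bool (f p = v) * \<psi> k (p, q) else 0)"
        unfolding Pr_def by (rule sum.cong) auto
      then show ?thesis
        unfolding pq v apply_op_alice[OF fin pq(3)] using pq fin by (simp add: cut_def)
    qed
    then show "discriminable X Y K (\<lambda>k. apply_op (X \<times> Y) (tensor_op M id_op) (\<psi> k))"
      by (intro discriminable_cong[OF _ D[of v]]) auto
  qed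
qed

lemma discriminable_alice_refine:
  assumes "finite X" "finite Y"
    and "\<And>v. discriminable X Y K (\<lambda>k. cut (R \<inter> {z. f (fst z) = v}) (\<psi> k))"
  shows "discriminable X Y K (\<lambda>k. cut R (\<psi> k))"
  by (rule discriminable_alice_project[OF assms(1,2), of K f])
    (use assms(3) in \<open>simp only: cut_cut Int_commute\<close>)

text \<open>\<open>h\<close> may be written in terms of both labels: on \<open>R\<close> it depends
  on Bob's label alone, which makes it measurable by him.\<close>

lemma discriminable_bob_refine:
  assumes fin: "finite X" "finite Y"
    and h: "\<And>p p' q. (p, q) \<in> R \<Longrightarrow> (p', q) \<in> R \<Longrightarrow> h (p, q) = h (p', q)"
    and D: "\<And>v. discriminable X Y K (\<lambda>k. cut (R \<inter> {z. h z = v}) (\<psi> k))"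
  shows "discriminable X Y K (\<lambda>k. cut R (\<psi> k))"
proof (rule discriminable_flip, rule discriminable_alice_project[OF fin(2) fin(1)])
  fix v
  \<comment> \<open>Any partner \<open>p\<close> gives the same value of \<open>h\<close>. If
    \<open>q\<close> has no partner in \<open>R\<close>, the value is arbitrary, but
    \<open>cut\<close> leaves no amplitude there.\<close>
  define f where "f q = h (SOME p. (p, q) \<in> R, q)" for q
  have f: "f q = h (p, q)" if "(p, q) \<in> R" for p q
    unfolding f_def by (rule h[OF _ that]) (rule someI[of "\<lambda>p. (p, q) \<in> R", OF that])
  have eq: "cut {z. f (fst z) = v} (swap_vect (cut R (\<psi> k))) = swap_vect (cut (R \<inter> {z. h z = v}) (\<psi> k))" for k
    using f by (fastforce simp: cut_def swap_vect_def)
  have "discriminable Y X K (\<lambda>k. swap_vect (cut (R \<inter> {z. h z = v}) (\<psi> k)))"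
    by (rule discriminable_flip) (use D in simp)
  then show "discriminable Y X K (\<lambda>k. cut {z. f (fst z) = v} (swap_vect (cut R (\<psi> k))))"
    unfolding eq .
qed

text \<open>
  Alice tests for one vector of the family after the other; by orthogonality a negative outcome
  leaves the remaining vectors unchanged. For a zero vector division by zero makes the test trivial.
\<close>

lemma discriminable_orthogonal_alice_aux:
  assumes fin: "finite X" "finite Y" and "finite K" "K \<subseteq> L"
    and "\<And>k x. k \<in> L - K \<Longrightarrow> x \<in> X \<Longrightarrow> v k x = 0"
    and "\<And>k z. k \<in> L \<Longrightarrow> z \<in> X \<times> Y \<Longrightarrow> \<psi> k z = v k (fst z) * of_bool (snd z = r)"
    and "\<And>k l. k \<in> L \<Longrightarrow> l \<in> L \<Longrightarrow> k \<noteq> l \<Longrightarrow> inner_on X (v k) (v l) = 0"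
  shows "discriminable X Y L \<psi>"
  using assms(3-)
\<comment> \<open>\<open>K\<close> holds the indices still to be tested; vectors with index outside
  it are already zero, so nothing is left to distinguish at the end.\<close>
proof (induction K arbitrary: \<psi> v rule: finite_induct)
  case empty
  then show ?case by (intro discriminable_stop) auto
next
  case (insert k0 K)
  define w where "w = v k0"
  define c where "c = inner_on X w w"
  define Pr where "Pr = (\<lambda>p p'. w p * cnj (w p') / c)"
  define Co where "Co = (\<lambda>p p'. id_op p p' - Pr p p')"
  have cnj_c: "cnj c = c"
    unfolding c_def inner_on_def by (simp add: mult.commute)
  \<comment> \<open>\<open>c / c\<close> is 1 or, for \<open>c = 0\<close>, 0 by convention; in that
    case \<open>w\<close> vanishes on \<open>X\<close>, so the equation survives.\<close>
  have wc: "w x * (c / c) = w x" if "x \<in> X" for x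
  proof (cases "c = 0")
    case True
    have "c = of_real (\<Sum>x\<in>X. (cmod (w x))\<^sup>2)"
      unfolding c_def inner_on_def of_real_sum
      by (rule sum.cong, rule refl, subst mult.commute, simp only: complex_norm_square)
    then show ?thesis
      using True fin that by (simp add: sum_nonneg_eq_0_iff del: of_real_sum)
  qed simp
  have PrPr: "mult_op X (adj_op Pr) Pr x y = Pr x y" if "x \<in> X" for x y
  proof -
    have "mult_op X (adj_op Pr) Pr x y = (\<Sum>z\<in>X. cnj (w z) * w z) * (w x * cnj (w y) / (c * c))"
      unfolding mult_op_def adj_op_def Pr_def sum_distrib_right
      by (rule sum.cong) (auto simp: cnj_c field_simps)
    also have "\<dots> = w x * (c / c) * cnj (w y) / c"
      by (simp add: c_def inner_on_def)
    finally show ?thesis using wc[OF that] by (simp add: Pr_def)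
  qed
  have adjPr: "cnj (Pr z x) = Pr x z" for x z
    by (simp add: Pr_def cnj_c mult.commute)
  have CoCo: "mult_op X (adj_op Co) Co x y = Co x y" if "x \<in> X" "y \<in> X" for x y
  proof -
    have "mult_op X (adj_op Co) Co x y =
      (\<Sum>z\<in>X. (if z = x then id_op x y else 0)) - (\<Sum>z\<in>X. (if z = x then Pr x y else 0)) -
      (\<Sum>z\<in>X. (if z = y then Pr x y else 0)) + mult_op X (adj_op Pr) Pr x y"
      unfolding mult_op_def adj_op_def Co_def sum_subtractf[symmetric] sum.distrib[symmetric]
      by (rule sum.cong) (auto simp: id_op_def adjPr algebra_simps)
    then show ?thesis using that fin PrPr by (simp add: Co_def)
  qed
  have meas: "is_measurement X [Pr, Co]"
    unfolding is_measurement_def using PrPr CoCo by (simp add: Co_def)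
  have Pr_app: "apply_op (X \<times> Y) (tensor_op Pr id_op) (\<psi> k) z = w (fst z) / c * inner_on X w (v k) * of_bool (snd z = r)"
    if k: "k \<in> L" and z: "z \<in> X \<times> Y" for k z
  proof -
    obtain p q where pq: "z = (p, q)" "p \<in> X" "q \<in> Y" using z by auto
    show ?thesis
      unfolding pq apply_op_alice[OF fin pq(3)] inner_on_def
      using insert.prems(3)[OF k] pq by (simp add: Pr_def sum_distrib_left sum_distrib_right mult_ac)
  qed
  have Co_app: "apply_op (X \<times> Y) (tensor_op Co id_op) (\<psi> k) z =
      (v k (fst z) - w (fst z) / c * inner_on X w (v k)) * of_bool (snd z = r)"
    if k: "k \<in> L" and z: "z \<in> X \<times> Y" for k z
  proof -
    obtain p q where pq: "z = (p, q)" "p \<in> X" "q \<in> Y" using z by auto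
    have "(\<Sum>p'\<in>X. Co p p' * \<psi> k (p', q)) = (\<Sum>p'\<in>X. if p' = p then \<psi> k (p, q) else 0) - (\<Sum>p'\<in>X. Pr p p' * \<psi> k (p', q))"
      unfolding sum_subtractf[symmetric] by (rule sum.cong) (auto simp: Co_def id_op_def algebra_simps)
    then have "apply_op (X \<times> Y) (tensor_op Co id_op) (\<psi> k) z = \<psi> k z - apply_op (X \<times> Y) (tensor_op Pr id_op) (\<psi> k) z"
      unfolding pq apply_op_alice[OF fin pq(3)] using pq fin by simp
    then show ?thesis
      using Pr_app[OF that] insert.prems(3)[OF that] by (simp add: algebra_simps)
  qed
  have k0: "k0 \<in> L" using insert.prems(1) by simp
  have other: "inner_on X w (v k) = 0" if "k \<in> L" "k \<noteq> k0" for k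
    using insert.prems(4)[OF k0 that(1)] that(2) by (auto simp: w_def)
  have self: "w x - w x / c * inner_on X w w = 0" if "x \<in> X" for x
    using wc[OF that] by (cases "c = 0") (auto simp: c_def)
  show ?case
  proof (rule discriminable_alice[OF meas])
    fix M assume "M \<in> set [Pr, Co]"
    then consider "M = Pr" | "M = Co" by auto
    then show "discriminable X Y L (\<lambda>k. apply_op (X \<times> Y) (tensor_op M id_op) (\<psi> k))"
    proof cases
      case 1
      have "k = k0" if "k \<in> L" "z \<in> X \<times> Y" "apply_op (X \<times> Y) (tensor_op Pr id_op) (\<psi> k) z \<noteq> 0" for k z
        using other[OF that(1)] that(3) Pr_app[OF that(1,2)] by auto
      then show ?thesis unfolding 1 by (intro discriminable_stop) metis
    next
      case 2
      \<comment> \<open>The tested vector has been annihilated; replacing it by zero keeps the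
        family orthogonal.\<close>
      define v' where "v' k = (if k = k0 then (\<lambda>x. 0) else v k)" for k
      show ?thesis unfolding 2
      proof (rule insert.IH[of v'])
        show "K \<subseteq> L" using insert.prems(1) by simp
        show "v' k x = 0" if "k \<in> L - K" "x \<in> X" for k x
          using that insert.prems(2)[of k x] by (auto simp: v'_def)
        show "apply_op (X \<times> Y) (tensor_op Co id_op) (\<psi> k) z = v' k (fst z) * of_bool (snd z = r)"
          if "k \<in> L" "z \<in> X \<times> Y" for k z
          unfolding Co_app[OF that] using other[OF that(1)] self[of "fst z"] that(2)
          by (cases "k = k0") (auto simp: v'_def w_def)
        show "inner_on X (v' k) (v' l) = 0" if "k \<in> L" "l \<in> L" "k \<noteq> l" for k l
          using insert.prems(4)[OF that] by (auto simp: v'_def inner_on_def)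
      qed
    qed
  qed
qed

lemma discriminable_orthogonal_alice:
  assumes "finite X" "finite Y" "finite K"
    and "\<And>k z. k \<in> K \<Longrightarrow> z \<in> X \<times> Y \<Longrightarrow> \<psi> k z = v k (fst z) * of_bool (snd z = r)"
    and "\<And>k l. k \<in> K \<Longrightarrow> l \<in> K \<Longrightarrow> k \<noteq> l \<Longrightarrow> inner_on X (v k) (v l) = 0"
  shows "discriminable X Y K \<psi>"
  by (rule discriminable_orthogonal_alice_aux[OF assms(1-3) subset_refl _ assms(4,5)]) simp_all

text \<open>
  If Bob's basis label determines Alice's, then a measurement of Alice in a basis unbiased to hers
  reveals nothing about the state and leaves all the information with Bob.
\<close>

lemma discriminable_orthogonal_if_bob_knows:
  assumes fin: "finite X" "finite Y" "finite K"
    and supp: "\<And>k l p p' q. k \<in> K \<Longrightarrow> l \<in> K \<Longrightarrow> p \<in> X \<Longrightarrow> p' \<in> X \<Longrightarrow> q \<in> Y \<Longrightarrow>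
      \<psi> k (p, q) \<noteq> 0 \<Longrightarrow> \<psi> l (p', q) \<noteq> 0 \<Longrightarrow> p = p'"
    and orth: "\<And>k l. k \<in> K \<Longrightarrow> l \<in> K \<Longrightarrow> k \<noteq> l \<Longrightarrow> inner_on (X \<times> Y) (\<psi> k) (\<psi> l) = 0"
  shows "discriminable X Y K \<psi>"
proof -
  define N where "N = card X"
  \<comment> \<open>Every Kraus operator below sends Alice to this one label, so that afterwards
    only Bob's part can differ between the states.\<close>
  define p0 :: 'a where "p0 = (SOME p. p \<in> X)"
  obtain idx where idx: "bij_betw idx X {..<N}"
    using ex_bij_betw_finite_nat[OF fin(1)] unfolding N_def lessThan_atLeast0 by blast
  define \<chi> where "\<chi> f p = root_of_unity N ^ (f * idx p)" for f p
  \<comment> \<open>Rank one operators for the Fourier basis on an enumeration of \<open>X\<close>;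
    all coefficients have the same modulus, so no outcome favours a label.\<close>
  define M where "M f = (\<lambda>p p'. of_bool (p = p0) * \<chi> f p' / of_real (sqrt N))" for f
  have \<chi>_norm: "cnj (\<chi> f p) * \<chi> f p = 1" for f p
    unfolding \<chi>_def root_of_unity_power cis_cnj by (simp add: cis_mult)
  have meas: "is_measurement X (map M [0..<N])"
    unfolding is_measurement_def
  proof (intro ballI)
    fix x y
    assume xy: "x \<in> X" "y \<in> X"
    then have N: "N > 0" unfolding N_def using fin by (auto simp: card_gt_0_iff)
    have p0: "p0 \<in> X" unfolding p0_def using xy(1) by (rule someI)
    have sq: "complex_of_real (sqrt N) * complex_of_real (sqrt N) = of_nat N"
      unfolding of_real_mult[symmetric] by simp
    have "mult_op X (adj_op (M f)) (M f) x y = cnj (\<chi> f x) * \<chi> f y / of_nat N" for f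
    proof -
      have "mult_op X (adj_op (M f)) (M f) x y = (\<Sum>z\<in>X. if z = p0 then cnj (\<chi> f x) * \<chi> f y / of_nat N else 0)"
        unfolding mult_op_def adj_op_def M_def by (rule sum.cong) (auto simp: sq)
      then show ?thesis using p0 fin by simp
    qed
    then have "(\<Sum>Mf\<leftarrow>map M [0..<N]. mult_op X (adj_op Mf) Mf x y) =
        (\<Sum>f<N. cnj (\<chi> f x) * \<chi> f y) / of_nat N"
      by (simp add: comp_def interv_sum_list_conv_sum_set_nat lessThan_atLeast0 sum_divide_distrib)
    also have "(\<Sum>f<N. cnj (\<chi> f x) * \<chi> f y) = of_nat N * of_bool (idx x = idx y)"
      unfolding \<chi>_def using xy idx by (intro fourier_orthogonal) (auto dest: bij_betwE)
    also have "(idx x = idx y) = (x = y)"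
      using xy idx by (auto simp: bij_betw_def dest: inj_onD)
    finally show "(\<Sum>Mf\<leftarrow>map M [0..<N]. mult_op X (adj_op Mf) Mf x y) = id_op x y"
      using N by (simp add: id_op_def)
  qed
  show ?thesis
  proof (rule discriminable_alice[OF meas])
    fix Mf assume "Mf \<in> set (map M [0..<N])"
    then obtain f where f: "Mf = M f" by auto
    define v where "v k q = (\<Sum>p\<in>X. \<chi> f p * \<psi> k (p, q)) / of_real (sqrt N)" for k q
    have v: "apply_op (X \<times> Y) (tensor_op (M f) id_op) (\<psi> k) (p, q) = v k q * of_bool (p = p0)"
      if "q \<in> Y" for k p q
      unfolding apply_op_alice[OF fin(1,2) that] M_def v_def
      by (simp add: sum_divide_distrib)
    show "discriminable X Y K (\<lambda>k. apply_op (X \<times> Y) (tensor_op Mf id_op) (\<psi> k))"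
      unfolding f
    proof (rule discriminable_flip, rule discriminable_orthogonal_alice[where v = v and r = p0, OF fin(2,1,3)])
      show "swap_vect (apply_op (X \<times> Y) (tensor_op (M f) id_op) (\<psi> k)) z = v k (fst z) * of_bool (snd z = p0)"
        if "k \<in> K" "z \<in> Y \<times> X" for k z
        using that v by (cases z) auto
      fix k l
      assume kl: "k \<in> K" "l \<in> K" "k \<noteq> l"
      have "cnj (v k q) * v l q = (\<Sum>p\<in>X. cnj (\<psi> k (p, q)) * \<psi> l (p, q)) / (of_real (sqrt N) * of_real (sqrt N))"
        if q: "q \<in> Y" for q
      proof -
        have "cnj (\<Sum>p\<in>X. \<chi> f p * \<psi> k (p, q)) * (\<Sum>p\<in>X. \<chi> f p * \<psi> l (p, q)) =
          (\<Sum>p\<in>X. \<Sum>p'\<in>X. cnj (\<chi> f p * \<psi> k (p, q)) * (\<chi> f p' * \<psi> l (p', q)))"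
          by (simp add: sum_product)
        \<comment> \<open>By \<open>supp\<close> at most one \<open>p\<close> carries amplitude
          above \<open>q\<close>, so the cross terms vanish; in the diagonal terms the phases
          cancel.\<close>
        also have "\<dots> = (\<Sum>p\<in>X. \<Sum>p'\<in>X. if p' = p then cnj (\<psi> k (p, q)) * \<psi> l (p, q) else 0)"
        proof (intro sum.cong refl)
          fix p p' assume "p \<in> X" "p' \<in> X"
          then show "cnj (\<chi> f p * \<psi> k (p, q)) * (\<chi> f p' * \<psi> l (p', q)) =
              (if p' = p then cnj (\<psi> k (p, q)) * \<psi> l (p, q) else 0)"
            using supp[OF kl(1,2) _ _ q, of p p'] \<chi>_norm[of f p]
            by (auto simp: mult_ac)
        qed
        finally show ?thesis unfolding v_def using fin by simp
      qed
      then have "inner_on Y (v k) (v l) =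
          (\<Sum>q\<in>Y. \<Sum>p\<in>X. cnj (\<psi> k (p, q)) * \<psi> l (p, q)) / (of_real (sqrt N) * of_real (sqrt N))"
        by (simp add: inner_on_def sum_divide_distrib)
      also have "(\<Sum>q\<in>Y. \<Sum>p\<in>X. cnj (\<psi> k (p, q)) * \<psi> l (p, q)) = inner_on (X \<times> Y) (\<psi> k) (\<psi> l)"
        unfolding inner_on_def by (subst sum.swap) (simp add: sum.cartesian_product)
      finally show "inner_on Y (v k) (v l) = 0" using orth[OF kl] by simp
    qed
  qed
qed

lemma discriminable_orthogonal_if_alice_knows:
  assumes fin: "finite X" "finite Y" "finite K"
    and supp: "\<And>k l p q q'. k \<in> K \<Longrightarrow> l \<in> K \<Longrightarrow> p \<in> X \<Longrightarrow> q \<in> Y \<Longrightarrow> q' \<in> Y \<Longrightarrow>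
      \<psi> k (p, q) \<noteq> 0 \<Longrightarrow> \<psi> l (p, q') \<noteq> 0 \<Longrightarrow> q = q'"
    and orth: "\<And>k l. k \<in> K \<Longrightarrow> l \<in> K \<Longrightarrow> k \<noteq> l \<Longrightarrow> inner_on (X \<times> Y) (\<psi> k) (\<psi> l) = 0"
  shows "discriminable X Y K \<psi>"
proof (rule discriminable_flip, rule discriminable_orthogonal_if_bob_knows[OF fin(2,1,3)])
  fix k l
  assume kl: "k \<in> K" "l \<in> K" "k \<noteq> l"
  have "inner_on (Y \<times> X) (swap_vect (\<psi> k)) (swap_vect (\<psi> l)) = inner_on (X \<times> Y) (\<psi> k) (\<psi> l)"
    unfolding inner_on_def
    by (rule sum.reindex_bij_witness[of _ prod.swap prod.swap]) auto
  then show "inner_on (Y \<times> X) (swap_vect (\<psi> k)) (swap_vect (\<psi> l)) = 0"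
    using orth[OF kl] by simp
qed (use supp in auto)

section \<open>The tiling of the square\<close>

text \<open>\<open>(True, k)\<close> is the support of the \<open>V\<close> states with row
  \<open>k\<close>, where \<open>y - x\<close> reduces modulo \<open>2 * n\<close> to a value in
  \<open>{1..n}\<close>; \<open>(False, k)\<close> is that of the \<open>H\<close> states with
  column \<open>k\<close>. The inequalities spell out the reduction.\<close>

definition tile :: "nat \<Rightarrow> nat \<times> nat \<Rightarrow> bool \<times> nat" where
  "tile n = (\<lambda>(x, y). if x < y \<and> y \<le> x + n \<or> y + n \<le> x then (True, x) else (False, y))"

text \<open>Recovers the summation index \<open>j\<close> of the Fourier sum; the branches undo the
  reduction modulo \<open>2 * n\<close> without negative differences.\<close>

definition pos :: "nat \<Rightarrow> nat \<times> nat \<Rightarrow> nat" where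
  "pos n = (\<lambda>(x, y). if fst (tile n (x, y))
     then (if x < y then y - x - 1 else y + 2 * n - x - 1)
     else (if y \<le> x then x - y else x + 2 * n - y))"

definition cells :: "nat \<Rightarrow> bool \<times> nat \<Rightarrow> (nat \<times> nat) set" where
  "cells n t = {z \<in> {..<2 * n} \<times> {..<2 * n}. tile n z = t}"

lemma mod_less_double: "a < 2 * n \<Longrightarrow> a mod n = (if a < n then a else a - n)" for a n :: nat
  by (simp add: mod_if)

text \<open>\<open>pos\<close> enumerates the \<open>n\<close> cells of a tile, with inverse the
  label map from the definition of the states; sums over a tile thus become Fourier sums.\<close>

lemma sum_cells:
  assumes "k < 2 * n"
  shows "(\<Sum>z\<in>cells n (b, k). g (pos n z)) = (\<Sum>j<n. g j)"
proof (cases b)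
  case True
  show ?thesis
    by (rule sum.reindex_bij_witness[of _ "\<lambda>j. (k, (j + k + 1) mod (2 * n))" "pos n"])
      (use assms True in \<open>auto simp: cells_def tile_def pos_def mod_less_double split: if_splits\<close>)
next
  case False
  show ?thesis
    by (rule sum.reindex_bij_witness[of _ "\<lambda>j. ((j + k) mod (2 * n), k)" "pos n"])
      (use assms False in \<open>auto simp: cells_def tile_def pos_def mod_less_double split: if_splits\<close>)
qed

section \<open>The given states on the tiles\<close>

lemma V_state_eq:
  assumes "x < 2 * n" "y < 2 * n" "k < 2 * n"
  shows "V_state n (2 * n) m k (x, y) =
    of_bool (tile n (x, y) = (True, k)) * root_of_unity n ^ (pos n (x, y) * m)"
proof -
  have "ket k x * (root_of_unity n ^ (j * m) * ket ((j + k + 1) mod (2 * n)) y) =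
      (if j = pos n (x, y) then of_bool (tile n (x, y) = (True, k)) * root_of_unity n ^ (j * m) else 0)"
    if "j < n" for j
    using that assms by (auto simp: ket_def tile_def pos_def mod_less_double split: if_splits)
  moreover have "pos n (x, y) < n"
    using assms by (auto simp: tile_def pos_def)
  ultimately show ?thesis
    by (simp add: V_state_def tensor_def sum_distrib_left)
qed

lemma H_state_eq:
  assumes "x < 2 * n" "y < 2 * n" "k < 2 * n"
  shows "H_state n (2 * n) m k (x, y) =
    of_bool (tile n (x, y) = (False, k)) * root_of_unity n ^ (pos n (x, y) * m)"
proof -
  have "(root_of_unity n ^ (j * m) * ket ((j + k) mod (2 * n)) x) * ket k y =
      (if j = pos n (x, y) then of_bool (tile n (x, y) = (False, k)) * root_of_unity n ^ (j * m) else 0)"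
    if "j < n" for j
    using that assms by (auto simp: ket_def tile_def pos_def mod_less_double split: if_splits)
  moreover have "pos n (x, y) < n"
    using assms by (auto simp: tile_def pos_def)
  ultimately show ?thesis
    by (simp add: H_state_def tensor_def sum_distrib_right)
qed

lemma stopper_eq:
  assumes "x < d" "y < d"
  shows "stopper d (x, y) = 1"
proof -
  have "stopper d (x, y) = (\<Sum>i<d. \<Sum>j<d. if j = y then (if i = x then 1 else 0) else 0)"
    unfolding stopper_def by (intro sum.cong refl) (auto simp: tensor_def ket_def)
  then show ?thesis using assms by simp
qed

text \<open>On a tile every state vanishes or is a Fourier vector, with the stopper at frequency \<open>0\<close>.\<close>

definition tile_state :: "nat \<Rightarrow> bool \<times> nat \<Rightarrow> nat \<Rightarrow> (nat \<times> nat) vect" where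
  "tile_state n = (\<lambda>(b, k) m. if m = 0 then stopper (2 * n)
     else if b then V_state n (2 * n) m k else H_state n (2 * n) m k)"

text \<open>The equation with \<open>tile_state\<close> makes the frequency identify the state: two
  different states in the second case for the same tile have different \<open>m\<close>.\<close>

lemma state_on_cells:
  assumes "\<phi> \<in> state_set n (2 * n)" "n > 0"
  shows "(\<forall>z\<in>cells n t. \<phi> z = 0) \<or>
    (\<exists>m<n. \<phi> = tile_state n t m \<and> (\<forall>z\<in>cells n t. \<phi> z = root_of_unity n ^ (pos n z * m)))"
proof -
  obtain b k where t: "t = (b, k)" by (cases t)
  from assms(1) consider
      (V) m l where "\<phi> = V_state n (2 * n) m l" "m \<in> {1..n-1}" "l < 2 * n"
    | (H) m l where "\<phi> = H_state n (2 * n) m l" "m \<in> {1..n-1}" "l < 2 * n"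
    | (F) "\<phi> = stopper (2 * n)"
    unfolding state_set_def by blast
  then show ?thesis
  proof cases
    case V
    show ?thesis
    proof (cases "t = (True, l)")
      case True
      have "m < n" using V(2) by auto
      moreover have "\<phi> = tile_state n t m" using V True by (simp add: tile_state_def)
      moreover have "\<forall>z\<in>cells n t. \<phi> z = root_of_unity n ^ (pos n z * m)"
        using V True by (auto simp: cells_def V_state_eq)
      ultimately show ?thesis by blast
    next
      case False
      then have "\<forall>z\<in>cells n t. \<phi> z = 0"
        using V by (auto simp: cells_def V_state_eq)
      then show ?thesis ..
    qed
  next
    case H
    show ?thesis
    proof (cases "t = (False, l)")
      case True
      have "m < n" using H(2) by auto
      moreover have "\<phi> = tile_state n t m" using H True by (simp add: tile_state_def)
      moreover have "\<forall>z\<in>cells n t. \<phi> z = root_of_unity n ^ (pos n z * m)"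
        using H True by (auto simp: cells_def H_state_eq)
      ultimately show ?thesis by blast
    next
      case False
      then have "\<forall>z\<in>cells n t. \<phi> z = 0"
        using H by (auto simp: cells_def H_state_eq)
      then show ?thesis ..
    qed
  next
    case F
    then have "\<phi> = tile_state n t 0" by (simp add: tile_state_def t)
    moreover have "\<forall>z\<in>cells n t. \<phi> z = root_of_unity n ^ (pos n z * 0)"
      using F by (auto simp: cells_def stopper_eq)
    ultimately show ?thesis using assms(2) by blast
  qed
qed

lemma orthogonal_on_cells:
  assumes "\<phi> \<in> state_set n (2 * n)" "\<phi>' \<in> state_set n (2 * n)" "\<phi> \<noteq> \<phi>'" "n > 0"
  shows "inner_on (cells n t) \<phi> \<phi>' = 0"
proof -
  obtain b k where t: "t = (b, k)" by (cases t)
  consider "\<forall>z\<in>cells n t. \<phi> z = 0" | "\<forall>z\<in>cells n t. \<phi>' z = 0" | "k \<ge> 2 * n"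
    | m m' where "k < 2 * n" "m < n" "m' < n" "m \<noteq> m'"
      "\<forall>z\<in>cells n t. \<phi> z = root_of_unity n ^ (pos n z * m)"
      "\<forall>z\<in>cells n t. \<phi>' z = root_of_unity n ^ (pos n z * m')"
    using state_on_cells[OF assms(1,4), of t] state_on_cells[OF assms(2,4), of t] assms(3)
    by (metis not_le)
  then show ?thesis
  proof cases
    case 4
    have "inner_on (cells n t) \<phi> \<phi>' =
      (\<Sum>z\<in>cells n t. cnj (root_of_unity n ^ (pos n z * m)) * root_of_unity n ^ (pos n z * m'))"
      using 4 by (simp add: inner_on_def)
    also have "\<dots> = (\<Sum>j<n. cnj (root_of_unity n ^ (j * m)) * root_of_unity n ^ (j * m'))"
      unfolding t by (rule sum_cells[OF 4(1)])
    finally show ?thesis using fourier_orthogonal[OF 4(2,3)] 4(4) by simp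
  next
    case 3
    then have "cells n t = {}" by (auto simp: t cells_def tile_def split: if_splits)
    then show ?thesis by (simp add: inner_on_def)
  qed (auto simp: inner_on_def)
qed

lemma state_set_orthogonal:
  assumes "\<phi> \<in> state_set n (2 * n)" "\<phi>' \<in> state_set n (2 * n)" "\<phi> \<noteq> \<phi>'" "n > 0"
  shows "inner_on ({..<2 * n} \<times> {..<2 * n}) \<phi> \<phi>' = 0"
proof -
  let ?Z = "{..<2 * n} \<times> {..<2 * n}"
  have "inner_on ?Z \<phi> \<phi>' = (\<Sum>t\<in>tile n ` ?Z. inner_on (cells n t) \<phi> \<phi>')"
    unfolding inner_on_def cells_def by (rule sum.group[symmetric]) auto
  then show ?thesis using orthogonal_on_cells[OF assms] by simp
qed

lemma finite_state_set: "finite (state_set n d)"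
  unfolding state_set_def finite_Un by (intro conjI finite_image_set2) simp_all

section \<open>The protocol\<close>

lemma finite_qubit_strings: "finite (qubit_strings r)"
  and card_qubit_strings: "card (qubit_strings r) = 2 ^ r"
  using finite_lists_length_eq[of "{0, 1 :: nat}" r] card_lists_length_eq[of "{0, 1 :: nat}" r]
  by (auto simp: qubit_strings_def conj_commute numeral_2_eq_2)

text \<open>The product of pairs is, up to normalization, a single maximally entangled state with
  bit strings as labels; the resource is used only in this form.\<close>

lemma bell_copies_eq:
  assumes "s \<in> qubit_strings r" "t \<in> qubit_strings r"
  shows "bell_copies r (s, t) = of_bool (s = t)"
proof -
  have bit: "x ! l = 0 \<or> x ! l = 1" if "x \<in> qubit_strings r" "l < r" for x l
  proof -
    have "x ! l \<in> set x" "set x \<subseteq> {0, 1}" using that by (auto simp: qubit_strings_def)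
    then show ?thesis by blast
  qed
  have "bell (s ! l, t ! l) = of_bool (s ! l = t ! l)" if "l < r" for l
    using bit[OF assms(1) that] bit[OF assms(2) that] by (auto simp: bell_def tensor_def ket_def)
  then have "bell_copies r (s, t) = (\<Prod>l<r. of_bool (s ! l = t ! l))"
    by (simp add: bell_copies_def)
  also have "\<dots> = of_bool (\<forall>l<r. s ! l = t ! l)"
    by (cases "\<forall>l<r. s ! l = t ! l") auto
  also have "(\<forall>l<r. s ! l = t ! l) = (s = t)"
    using assms by (auto simp: qubit_strings_def intro: nth_equalityI)
  finally show ?thesis .
qed

text \<open>A vanishing vector after the protocol has probability 0 whatever the norm of the initial
  state.\<close>

lemma locc_distinguishable_withI:
  assumes "discriminable (a \<times> A) (b \<times> B) S (with_resource \<Psi>)"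
  shows "locc_distinguishable_with a b \<Psi> A B S"
proof -
  obtain P where P: "is_locc (a \<times> A) (b \<times> B) P" "\<And>xs. complete_outcomes P xs \<Longrightarrow>
      \<exists>\<^sub>\<le>\<^sub>1\<phi>. \<phi> \<in> S \<and> (\<exists>z\<in>(a \<times> A) \<times> (b \<times> B). post_state (a \<times> A) (b \<times> B) P xs (with_resource \<Psi> \<phi>) z \<noteq> 0)"
    using assms unfolding discriminable_def by blast
  have "\<exists>z\<in>(a \<times> A) \<times> (b \<times> B). post_state (a \<times> A) (b \<times> B) P xs (with_resource \<Psi> \<phi>) z \<noteq> 0"
    if "outcome_prob (a \<times> A) (b \<times> B) P xs (with_resource \<Psi> \<phi>) \<noteq> 0" for xs \<phi>
  proof (rule ccontr)
    assume "\<not> ?thesis"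
    then have "norm_sq_on ((a \<times> A) \<times> (b \<times> B)) (post_state (a \<times> A) (b \<times> B) P xs (with_resource \<Psi> \<phi>)) = 0"
      by (auto simp: norm_sq_on_def intro!: sum.neutral)
    then show False using that by (simp add: outcome_prob_def)
  qed
  then have "\<exists>\<^sub>\<le>\<^sub>1\<phi>. \<phi> \<in> S \<and> outcome_prob (a \<times> A) (b \<times> B) P xs (with_resource \<Psi> \<phi>) \<noteq> 0"
    if "complete_outcomes P xs" for xs
    using P(2)[OF that] unfolding Uniq_def by blast
  then show ?thesis using P(1) unfolding locc_distinguishable_with_def by blast
qed

section \<open>Row classes and how they meet the tiles\<close>

definition row_class :: "nat \<Rightarrow> nat \<Rightarrow> nat" where
  "row_class n x = (if x = 0 then 0 else if x \<le> n then x - 1 else x - 2)"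

text \<open>The classes are numbered 0 to \<open>2 * n - 3\<close>. With \<open>n = k + 2\<close>
  their number is \<open>2 * k + 2 \<le> 2 * 2 ^ k\<close>; equality for \<open>n = 2\<close> and
  \<open>n = 3\<close> leaves no room for another class.\<close>

lemma row_class_less:
  assumes "x < 2 * n" "n \<ge> 2"
  shows "row_class n x < 2 ^ (n - 1)"
proof -
  obtain k where k: "n = k + 2" using \<open>n \<ge> 2\<close> by (metis add.commute le_Suc_ex)
  have "k < 2 ^ k" by (rule less_exp)
  moreover have "row_class n x \<le> 2 * k + 1"
    using assms by (auto simp: row_class_def k)
  moreover have "2 ^ (n - 1) = 2 * (2 ^ k :: nat)" by (simp add: k)
  ultimately show ?thesis by linarith
qed

text \<open>
  The six tiles that Bob must not separate yet: a column together with one of the two-row classes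
  can meet two of them, and this chains all six together.
\<close>

definition linked_tiles :: "nat \<Rightarrow> (bool \<times> nat) set" where
  "linked_tiles n = {(True, 0), (True, 1), (True, n), (True, n + 1), (False, 1), (False, n + 1)}"

lemma row_class_eqD:
  assumes "row_class n x = row_class n x'" "n \<ge> 2" "x \<noteq> x'"
  shows "x \<in> {0, 1} \<and> x' \<in> {0, 1} \<or> x \<in> {n, n + 1} \<and> x' \<in> {n, n + 1}"
  using assms by (auto simp: row_class_def split: if_splits)

text \<open>Rows 0 and 1 meet \<open>(True, 0)\<close> and \<open>(False, 1)\<close> in column 1,
  \<open>(True, 0)\<close> and \<open>(True, 1)\<close> in columns 2 to \<open>n\<close>,
  \<open>(False, n + 1)\<close> and \<open>(True, 1)\<close> in column \<open>n + 1\<close>, and a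
  common tile elsewhere. Rows \<open>n\<close>, \<open>n + 1\<close> show the same picture shifted
  by \<open>n\<close> in both coordinates modulo \<open>2 * n\<close>.\<close>

lemma same_row_class_tiles:
  assumes "row_class n x = row_class n x'" "n \<ge> 2" "y < 2 * n"
  shows "tile n (x, y) = tile n (x', y) \<or> {tile n (x, y), tile n (x', y)} \<subseteq> linked_tiles n"
proof (cases "x = x'")
  case False
  show ?thesis
    using row_class_eqD[OF assms(1,2) False] assms(2,3)
    by (auto simp: tile_def linked_tiles_def)
qed simp

text \<open>A \<open>V\<close> tile lies in one row. The tile \<open>(False, 1)\<close> fills rows 1
  to \<open>n\<close>, and \<open>(False, n + 1)\<close> fills the complementary rows.\<close>

lemma linked_tiles_half:
  assumes "z \<in> cells n t" "z' \<in> cells n t" "t \<in> linked_tiles n" "n \<ge> 2"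
  shows "fst z \<in> {1..n} \<longleftrightarrow> fst z' \<in> {1..n}"
  using assms by (auto simp: cells_def tile_def linked_tiles_def split: if_splits)

definition cell :: "('p \<times> nat) \<times> ('q \<times> nat) \<Rightarrow> nat \<times> nat" where
  "cell z = (snd (fst z), snd (snd z))"

text \<open>
  The support of the joint state once Alice has measured the sum modulo \<open>2 ^ (n - 1)\<close> of her
  resource label and the class of her row and has found \<open>u\<close>: the common resource label now encodes
  the class of the row, without destroying superpositions of rows.
\<close>

definition shared :: "(nat list \<Rightarrow> nat) \<Rightarrow> nat \<Rightarrow> nat \<Rightarrow> ((nat list \<times> nat) \<times> (nat list \<times> nat)) set" where
  "shared e n u = {((a, x), (b, y)). a \<in> qubit_strings (n - 1) \<and> b = a \<and> x < 2 * n \<and> y < 2 * n \<and>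
     (e a + row_class n x) mod 2 ^ (n - 1) = u}"

text \<open>Bob's string equals Alice's, so both sums contain the same \<open>e a\<close>; it
  cancels modulo \<open>2 ^ (n - 1)\<close>, and classes below the modulus are equal once
  congruent.\<close>

lemma shared_row_class:
  assumes "(p, q) \<in> shared e n u" "(p', q) \<in> shared e n u" "n \<ge> 2"
    and e: "bij_betw e (qubit_strings (n - 1)) {..<2 ^ (n - 1)}"
  shows "row_class n (snd p) = row_class n (snd p')"
proof -
  have p: "fst p' = fst p" "fst p \<in> qubit_strings (n - 1)" "snd p < 2 * n" "snd p' < 2 * n"
    "(e (fst p) + row_class n (snd p)) mod 2 ^ (n - 1) = (e (fst p) + row_class n (snd p')) mod 2 ^ (n - 1)"
    using assms(1,2) by (auto simp: shared_def)
  have "e (fst p) < 2 ^ (n - 1)" using bij_betwE[OF e] p by auto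
  moreover have "row_class n (snd p) < 2 ^ (n - 1)" "row_class n (snd p') < 2 ^ (n - 1)"
    using p row_class_less \<open>n \<ge> 2\<close> by auto
  ultimately show ?thesis
    using p(5) by (auto simp: mod_less_double split: if_splits)
qed

text \<open>For every cell exactly one resource string is compatible with outcome \<open>u\<close>,
  so no cell is duplicated or lost, and inner products over a tile carry over unchanged.\<close>

lemma bij_betw_cell:
  assumes e: "bij_betw e (qubit_strings (n - 1)) {..<2 ^ (n - 1)}" and "n \<ge> 2" "u < 2 ^ (n - 1)"
  shows "bij_betw cell (shared e n u \<inter> {z. tile n (cell z) = t}) (cells n t)"
proof -
  have uniq: "a = a'" if "((a, x), (a, y)) \<in> shared e n u" "((a', x), (a', y)) \<in> shared e n u" for a a' x y
  proof -
    have "e a < 2 ^ (n - 1)" "e a' < 2 ^ (n - 1)"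
      using that e by (auto simp: shared_def dest: bij_betwE)
    moreover have "row_class n x < 2 ^ (n - 1)"
      using that row_class_less \<open>n \<ge> 2\<close> by (auto simp: shared_def)
    moreover have "(e a + row_class n x) mod 2 ^ (n - 1) = (e a' + row_class n x) mod 2 ^ (n - 1)"
      using that by (simp add: shared_def)
    ultimately have "e a = e a'"
      by (auto simp: mod_less_double split: if_splits)
    then show ?thesis
      using that e by (auto simp: shared_def bij_betw_def dest: inj_onD)
  qed
  have ex: "\<exists>a. ((a, x), (a, y)) \<in> shared e n u" if "x < 2 * n" "y < 2 * n" for x y
  proof -
    define s where "s = row_class n x"
    \<comment> \<open>This is \<open>u - s\<close> modulo \<open>2 ^ (n - 1)\<close>, written
      without truncated subtraction.\<close>
    define i where "i = (if s \<le> u then u - s else u + 2 ^ (n - 1) - s)"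
    have s: "s < 2 ^ (n - 1)" unfolding s_def by (rule row_class_less) fact+
    then have i: "i < 2 ^ (n - 1)" "(i + s) mod 2 ^ (n - 1) = u"
      using \<open>u < 2 ^ (n - 1)\<close> by (auto simp: i_def)
    then have "i \<in> e ` qubit_strings (n - 1)"
      using e by (simp add: bij_betw_def)
    then obtain a where "a \<in> qubit_strings (n - 1)" "e a = i"
      by blast
    then show ?thesis
      using i that by (auto simp: shared_def s_def)
  qed
  show ?thesis
    unfolding bij_betw_def
  proof (intro conjI equalityI subsetI inj_onI)
    fix z z' assume "z \<in> shared e n u \<inter> {z. tile n (cell z) = t}" "z' \<in> shared e n u \<inter> {z. tile n (cell z) = t}"
      "cell z = cell z'"
    moreover from this obtain a a' x y where "z = ((a, x), (a, y))" "z' = ((a', x), (a', y))"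
      by (cases z; cases z') (auto simp: cell_def shared_def)
    ultimately show "z = z'"
      using uniq[of a x y a'] by simp
  next
    fix c assume "c \<in> cells n t"
    then obtain x y where xy: "c = (x, y)" "x < 2 * n" "y < 2 * n" "tile n (x, y) = t"
      by (auto simp: cells_def)
    from ex[OF xy(2,3)] obtain a where "((a, x), (a, y)) \<in> shared e n u" ..
    with xy show "c \<in> cell ` (shared e n u \<inter> {z. tile n (cell z) = t})"
      by (intro image_eqI[of _ _ "((a, x), (a, y))"]) (auto simp: cell_def)
  qed (auto simp: cells_def shared_def cell_def)
qed

section \<open>The rounds of the protocol, last one first\<close>

lemma with_resource_shared:
  "z \<in> shared e n u \<Longrightarrow> with_resource (bell_copies (n - 1)) \<phi> z = \<phi> (cell z)"
  by (auto simp: shared_def with_resource_def tensor_def cell_def bell_copies_eq)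

text \<open>Inner products are those on the cells of \<open>t\<close>. A \<open>V\<close> tile has a
  single row and the strings agree, so Bob's label fixes Alice's; an \<open>H\<close> tile has a
  single column, and the roles are exchanged.\<close>

lemma discriminable_one_tile:
  fixes n :: nat
  defines "X \<equiv> qubit_strings (n - 1) \<times> {..<2 * n}"
  assumes e: "bij_betw e (qubit_strings (n - 1)) {..<2 ^ (n - 1)}" and n: "n \<ge> 2"
  shows "discriminable X X (state_set n (2 * n))
    (\<lambda>\<phi>. cut (shared e n u \<inter> {z. tile n (cell z) = t}) (with_resource (bell_copies (n - 1)) \<phi>))"
    (is "discriminable X X ?S ?\<psi>")
proof -
  let ?R = "shared e n u \<inter> {z. tile n (cell z) = t}"
  have fin: "finite X" "finite X" "finite ?S"
    unfolding X_def using finite_qubit_strings finite_state_set by auto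
  have sub: "?R \<subseteq> X \<times> X" by (auto simp: shared_def X_def)
  have in_R: "z \<in> ?R" if "?\<psi> \<phi> z \<noteq> 0" for \<phi> z
    using that by (auto simp: cut_def)
  have orth: "inner_on (X \<times> X) (?\<psi> \<phi>) (?\<psi> \<phi>') = 0" if "\<phi> \<in> ?S" "\<phi>' \<in> ?S" "\<phi> \<noteq> \<phi>'" for \<phi> \<phi>'
  proof (cases "u < 2 ^ (n - 1)")
    case True
    have "inner_on (X \<times> X) (?\<psi> \<phi>) (?\<psi> \<phi>') = (\<Sum>z\<in>?R. cnj (\<phi> (cell z)) * \<phi>' (cell z))"
      unfolding inner_on_def
      by (rule sum.mono_neutral_cong_right)
        (use fin sub in \<open>auto simp: cut_def with_resource_shared[simplified]\<close>)
    also have "\<dots> = inner_on (cells n t) \<phi> \<phi>'"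
      unfolding inner_on_def by (rule sum.reindex_bij_betw[OF bij_betw_cell[OF e n True]])
    finally show ?thesis using orthogonal_on_cells[OF that] n by simp
  next
    case False
    \<comment> \<open>\<open>u\<close> is arbitrary here; a value beyond the range of the reduction
      is an outcome that never occurs.\<close>
    then have "shared e n u = {}" by (auto simp: shared_def)
    then show ?thesis by (simp add: inner_on_def cut_def)
  qed
  show ?thesis
  proof (cases "fst t")
    case True
    show ?thesis
    proof (rule discriminable_orthogonal_if_bob_knows[OF fin _ orth])
      fix \<phi> \<phi>' p p' q
      assume "?\<psi> \<phi> (p, q) \<noteq> 0" "?\<psi> \<phi>' (p', q) \<noteq> 0"
      then have "(p, q) \<in> ?R" "(p', q) \<in> ?R" by (blast dest: in_R)+
      then show "p = p'"
        using True by (cases p; cases p'; cases q) (auto simp: shared_def cell_def tile_def split: if_splits)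
    qed
  next
    case False
    show ?thesis
    proof (rule discriminable_orthogonal_if_alice_knows[OF fin _ orth])
      fix \<phi> \<phi>' p q q'
      assume "?\<psi> \<phi> (p, q) \<noteq> 0" "?\<psi> \<phi>' (p, q') \<noteq> 0"
      then have "(p, q) \<in> ?R" "(p, q') \<in> ?R" by (blast dest: in_R)+
      then show "q = q'"
        using False by (cases p; cases q; cases q') (auto simp: shared_def cell_def tile_def split: if_splits)
    qed
  qed
qed

lemma discriminable_cut_empty: "discriminable X Y K (\<lambda>k. cut {} (\<psi> k))"
  by (rule discriminable_stop) (simp add: cut_def)

lemma discriminable_linked_tiles:
  fixes n :: nat
  defines "X \<equiv> qubit_strings (n - 1) \<times> {..<2 * n}"
  assumes e: "bij_betw e (qubit_strings (n - 1)) {..<2 ^ (n - 1)}" and n: "n \<ge> 2"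
  shows "discriminable X X (state_set n (2 * n))
    (\<lambda>\<phi>. cut (shared e n u \<inter> {z. tile n (cell z) \<in> linked_tiles n}) (with_resource (bell_copies (n - 1)) \<phi>))"
proof -
  have fin: "finite X" "finite X"
    unfolding X_def using finite_qubit_strings by auto
  have one_tile: "discriminable X X (state_set n (2 * n))
      (\<lambda>\<phi>. cut (shared e n u \<inter> {z. tile n (cell z) = t}) (with_resource (bell_copies (n - 1)) \<phi>))" for t
    unfolding X_def by (rule discriminable_one_tile[OF e n])
  show ?thesis
  proof (rule discriminable_alice_refine[OF fin, where f = "\<lambda>p. snd p \<in> {1..n}"])
    fix v
    let ?R = "shared e n u \<inter> {z. tile n (cell z) \<in> linked_tiles n} \<inter> {z. (snd (fst z) \<in> {1..n}) = v}"
    show "discriminable X X (state_set n (2 * n)) (\<lambda>\<phi>. cut ?R (with_resource (bell_copies (n - 1)) \<phi>))"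
    proof (rule discriminable_bob_refine[OF fin, where h = "\<lambda>z. tile n (cell z)"])
      fix p p' q
      assume pq: "(p, q) \<in> ?R" "(p', q) \<in> ?R"
      then have "row_class n (snd p) = row_class n (snd p')"
        by (intro shared_row_class[OF _ _ n e]) blast+
      moreover have "snd p \<in> {1..n} \<longleftrightarrow> snd p' \<in> {1..n}"
        using pq by simp
      \<comment> \<open>\<open>{1..n}\<close> contains 1 but not 0, and \<open>n\<close> but not
        \<open>n + 1\<close>: within a two-row class the half determines the row.\<close>
      ultimately have "snd p = snd p'"
        using row_class_eqD[of n "snd p" "snd p'"] n by fastforce
      then show "tile n (cell (p, q)) = tile n (cell (p', q))"
        by (simp add: cell_def)
    next
      fix t
      show "discriminable X X (state_set n (2 * n)) (\<lambda>\<phi>. cut (?R \<inter> {z. tile n (cell z) = t}) (with_resource (bell_copies (n - 1)) \<phi>))"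
      proof (cases "?R \<inter> {z. tile n (cell z) = t} = {}")
        case True
        show ?thesis unfolding True by (rule discriminable_cut_empty)
      next
        case False
        then obtain w where w: "w \<in> ?R" "tile n (cell w) = t" by blast
        have half: "(snd (fst z) \<in> {1..n}) = v" if "z \<in> shared e n u" "tile n (cell z) = t" for z
        proof -
          have "cell z \<in> cells n t" "cell w \<in> cells n t"
            using that w by (auto simp: cells_def shared_def cell_def)
          then have "fst (cell z) \<in> {1..n} \<longleftrightarrow> fst (cell w) \<in> {1..n}"
            by (rule linked_tiles_half) (use w n in auto)
          then show ?thesis using w by (simp add: cell_def)
        qed
        \<comment> \<open>No linked tile straddles the two halves, so Alice's measurement has not
          removed a part of tile \<open>t\<close>.\<close>
        have "?R \<inter> {z. tile n (cell z) = t} = shared e n u \<inter> {z. tile n (cell z) = t}"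
        proof (intro equalityI subsetI)
          fix z assume "z \<in> shared e n u \<inter> {z. tile n (cell z) = t}"
          moreover have "t \<in> linked_tiles n" using w by simp
          ultimately show "z \<in> ?R \<inter> {z. tile n (cell z) = t}"
            using half[of z] by simp
        qed simp
        then show ?thesis by (simp only: one_tile)
      qed
    qed
  qed
qed

lemma discriminable_known_class:
  fixes n :: nat
  defines "X \<equiv> qubit_strings (n - 1) \<times> {..<2 * n}"
  assumes e: "bij_betw e (qubit_strings (n - 1)) {..<2 ^ (n - 1)}" and n: "n \<ge> 2"
  shows "discriminable X X (state_set n (2 * n)) (\<lambda>\<phi>. cut (shared e n u) (with_resource (bell_copies (n - 1)) \<phi>))"
proof -
  have fin: "finite X" "finite X"
    unfolding X_def using finite_qubit_strings by auto
  have one_tile: "discriminable X X (state_set n (2 * n))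
      (\<lambda>\<phi>. cut (shared e n u \<inter> {z. tile n (cell z) = t}) (with_resource (bell_copies (n - 1)) \<phi>))" for t
    unfolding X_def by (rule discriminable_one_tile[OF e n])
  have linked: "discriminable X X (state_set n (2 * n))
      (\<lambda>\<phi>. cut (shared e n u \<inter> {z. tile n (cell z) \<in> linked_tiles n}) (with_resource (bell_copies (n - 1)) \<phi>))"
    unfolding X_def by (rule discriminable_linked_tiles[OF e n])
  show ?thesis
  \<comment> \<open>Outcome \<open>None\<close> stands for the whole linked group; any other tile is
    determined by Bob's column and the row class.\<close>
  proof (rule discriminable_bob_refine[OF fin,
      where h = "\<lambda>z. let t = tile n (cell z) in if t \<in> linked_tiles n then None else Some t"])
    fix p p' q
    assume pq: "(p, q) \<in> shared e n u" "(p', q) \<in> shared e n u"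
    have "row_class n (snd p) = row_class n (snd p')"
      using pq by (rule shared_row_class[OF _ _ n e])
    moreover have "snd q < 2 * n"
      using pq by (auto simp: shared_def)
    ultimately have "tile n (snd p, snd q) = tile n (snd p', snd q) \<or>
        {tile n (snd p, snd q), tile n (snd p', snd q)} \<subseteq> linked_tiles n"
      by (intro same_row_class_tiles n)
    then
    show "(let t = tile n (cell (p, q)) in if t \<in> linked_tiles n then None else Some t) =
        (let t = tile n (cell (p', q)) in if t \<in> linked_tiles n then None else Some t)"
      by (auto simp: cell_def Let_def)
  next
    fix v :: "(bool \<times> nat) option"
    let ?h = "\<lambda>z :: (nat list \<times> nat) \<times> (nat list \<times> nat).
      let t = tile n (cell z) in if t \<in> linked_tiles n then None else Some t"
    consider "v = None" | t where "v = Some t" "t \<in> linked_tiles n"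
      | t where "v = Some t" "t \<notin> linked_tiles n"
      by (cases v) auto
    then show "discriminable X X (state_set n (2 * n)) (\<lambda>\<phi>. cut (shared e n u \<inter> {z. ?h z = v}) (with_resource (bell_copies (n - 1)) \<phi>))"
    proof cases
      case 1
      then have "shared e n u \<inter> {z. ?h z = v} = shared e n u \<inter> {z. tile n (cell z) \<in> linked_tiles n}"
        by (auto simp: Let_def)
      then show ?thesis using linked by simp
    next
      case (2 t)
      then have "shared e n u \<inter> {z. ?h z = v} = {}" by (auto simp: Let_def split: if_splits)
      then show ?thesis using discriminable_cut_empty by simp
    next
      case (3 t)
      then have "shared e n u \<inter> {z. ?h z = v} = shared e n u \<inter> {z. tile n (cell z) = t}"
        by (auto simp: Let_def split: if_splits)
      then show ?thesis using one_tile by simp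
    qed
  qed
qed

lemma discriminable_state_set:
  fixes n :: nat
  defines "X \<equiv> qubit_strings (n - 1) \<times> {..<2 * n}"
  assumes n: "n \<ge> 2"
  shows "discriminable X X (state_set n (2 * n)) (with_resource (bell_copies (n - 1)))"
    (is "discriminable X X ?S ?\<psi>")
proof -
  obtain e :: "nat list \<Rightarrow> nat" where e: "bij_betw e (qubit_strings (n - 1)) {..<2 ^ (n - 1)}"
    using ex_bij_betw_finite_nat[OF finite_qubit_strings[of "n - 1"]]
    unfolding card_qubit_strings lessThan_atLeast0 by blast
  have fin: "finite X" "finite X"
    unfolding X_def using finite_qubit_strings by auto
  have known_class: "discriminable X X ?S (\<lambda>\<phi>. cut (shared e n u) (?\<psi> \<phi>))" for u
    unfolding X_def by (rule discriminable_known_class[OF e n])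
  show ?thesis
  \<comment> \<open>The uniformly superposed string masks the class of the row, so the outcome does
    not disturb superpositions of rows.\<close>
  proof (rule discriminable_alice_project[OF fin, where f = "\<lambda>(a, x). (e a + row_class n x) mod 2 ^ (n - 1)"])
    fix u
    show "discriminable X X ?S (\<lambda>\<phi>. cut {z. (case fst z of (a, x) \<Rightarrow> (e a + row_class n x) mod 2 ^ (n - 1)) = u} (?\<psi> \<phi>))"
    \<comment> \<open>\<open>bell_copies\<close> vanishes for unequal strings, so the condition
      \<open>b = a\<close> in \<open>shared\<close> removes no amplitude.\<close>
    proof (rule discriminable_cong[OF _ known_class[of u]])
      fix \<phi> z
      assume "z \<in> X \<times> X"
      then obtain a x b y where "z = ((a, x), (b, y))" "a \<in> qubit_strings (n - 1)" "b \<in> qubit_strings (n - 1)"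
          "x < 2 * n" "y < 2 * n"
        unfolding X_def by auto
      then show "cut (shared e n u) (?\<psi> \<phi>) z =
          cut {z. (case fst z of (a, x) \<Rightarrow> (e a + row_class n x) mod 2 ^ (n - 1)) = u} (?\<psi> \<phi>) z"
        by (simp add: cut_def shared_def with_resource_def tensor_def bell_copies_eq)
    qed
  qed
qed

theorem theorem5:
  fixes n d :: nat
  assumes "n \<ge> 2" and "d = 2 * n"
  shows "pairwise (\<lambda>\<phi> \<psi>. inner_on ({..<d} \<times> {..<d}) \<phi> \<psi> = 0) (state_set n d) \<and>
    locc_distinguishable_with
      (qubit_strings (n - 1)) (qubit_strings (n - 1)) (bell_copies (n - 1))
      {..<d} {..<d} (state_set n d)"
proof
  show "pairwise (\<lambda>\<phi> \<psi>. inner_on ({..<d} \<times> {..<d}) \<phi> \<psi> = 0) (state_set n d)"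
    using state_set_orthogonal assms by (auto simp: pairwise_def)
  show "locc_distinguishable_with
      (qubit_strings (n - 1)) (qubit_strings (n - 1)) (bell_copies (n - 1))
      {..<d} {..<d} (state_set n d)"
    unfolding assms(2) by (rule locc_distinguishable_withI) (rule discriminable_state_set[OF assms(1)])
qed

end
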